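(* Let $n \geq 13$ be an integer. Among all triangle-free graphs $G$ with $n$ vertices, the Turán graph $K_{\lfloor n/2\rfloor,\lceil n/2\rceil}$ maximizes $n(S_{1,3},G)$; that is, $n(S_{1,3},G)\le n(S_{1,3},K_{\lfloor n/2\rfloor,\lceil n/2\rceil})$ for every triangle-free graph $G$ with $n$ vertices.
   Context: Graphs are finite and simple. For graphs $H$ and $G$, $n(H,G)$ denotes the number of (not necessarily induced) subgraphs of $G$ isomorphic to $H$. The star of degree $a$ is $K_{1,a}$, whose central vertex is the vertex of the part of size $1$. The double star $S_{a,b}$ is the graph formed from disjoint stars $K_{1,a}$ and $K_{1,b}$ by joining their central vertices by an edge. $K_{p,q}$ is the complete bipartite graph with parts of sizes $p$ and $q$. *)

theory Defs
  imports Main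
begin

datatype 'a ugraph = UGraph (verts: "'a set") (edges: "'a set set")

definition simple_graph :: "'a ugraph \<Rightarrow> bool" where
  "simple_graph G \<longleftrightarrow>
     finite (verts G) \<and> (\<forall>e\<in>edges G. e \<subseteq> verts G \<and> card e = 2)"

definition subgraph_of :: "'a ugraph \<Rightarrow> 'a ugraph \<Rightarrow> bool" where
  "subgraph_of F G \<longleftrightarrow>
     simple_graph F \<and> verts F \<subseteq> verts G \<and> edges F \<subseteq> edges G"

definition isomorphic :: "'a ugraph \<Rightarrow> 'b ugraph \<Rightarrow> bool" where
  "isomorphic F H \<longleftrightarrow>
     (\<exists>f. bij_betw f (verts F) (verts H) \<and>
          (\<forall>x\<in>verts F. \<forall>y\<in>verts F. {x, y} \<in> edges F \<longleftrightarrow> {f x, f y} \<in> edges H))"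

definition copies :: "'b ugraph \<Rightarrow> 'a ugraph \<Rightarrow> nat" where
  "copies H G = card {F. subgraph_of F G \<and> isomorphic F H}"

definition triangle_free :: "'a ugraph \<Rightarrow> bool" where
  "triangle_free G \<longleftrightarrow>
     \<not> (\<exists>x y z. {x, y} \<in> edges G \<and> {y, z} \<in> edges G \<and> {x, z} \<in> edges G)"

definition complete_bipartite :: "nat \<Rightarrow> nat \<Rightarrow> (nat + nat) ugraph" where
  "complete_bipartite p q =
     UGraph (Inl ` {..<p} \<union> Inr ` {..<q}) {{Inl i, Inr j} | i j. i < p \<and> j < q}"

abbreviation star :: "nat \<Rightarrow> (nat + nat) ugraph" where
  "star a \<equiv> complete_bipartite 1 a"

text \<open>The central vertex of either star is \<open>Inl 0\<close>; the outer \<open>Inl\<close>/\<open>Inr\<close> makes the two stars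
  disjoint.\<close>

definition double_star :: "nat \<Rightarrow> nat \<Rightarrow> ((nat + nat) + (nat + nat)) ugraph" where
  "double_star a b =
     UGraph (Inl ` verts (star a) \<union> Inr ` verts (star b))
       ((\<lambda>e. Inl ` e) ` edges (star a) \<union> (\<lambda>e. Inr ` e) ` edges (star b) \<union>
        {{Inl (Inl 0), Inr (Inl 0)}})"

definition turan_graph2 :: "nat \<Rightarrow> (nat + nat) ugraph" where
  "turan_graph2 n = complete_bipartite (n div 2) ((n + 1) div 2)"

lemma simple_graph_turan_graph2: "simple_graph (turan_graph2 n)"
  unfolding simple_graph_def turan_graph2_def complete_bipartite_def by auto

lemma card_verts_turan_graph2: "card (verts (turan_graph2 n)) = n"
proof -
  have "card (verts (turan_graph2 n)) = n div 2 + (n + 1) div 2"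
    unfolding turan_graph2_def complete_bipartite_def ugraph.sel
    by (subst card_Un_disjoint) (auto simp: card_image)
  then show ?thesis by presburger
qed

lemma triangle_free_turan_graph2: "triangle_free (turan_graph2 n)"
  unfolding triangle_free_def turan_graph2_def complete_bipartite_def
  by (auto simp: doubleton_eq_iff)

lemma simple_graph_double_star: "simple_graph (double_star a b)"
  unfolding simple_graph_def double_star_def complete_bipartite_def
  by (auto simp: card_image)

end

theory Submission imports Defs Complex_Main begin

text \<open>
  In a triangle-free graph the two leaf sets of a double star can be chosen independently, because
  adjacent vertices have no common neighbour. For \<open>a \<noteq> b\<close> the two centres can be told apart, so the
  number of copies of \<open>S\<^sub>a\<^sub>,\<^sub>b\<close> is the sum of
  \<open>(d(u) - 1 choose a) (d(v) - 1 choose b)\<close> over all ordered pairs of adjacent vertices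
  (\<open>copies_double_star_eq\<close>). Hence each edge contributes a weight \<open>w(d(u), d(v))\<close> which is symmetric
  and nondecreasing in both degrees, and \<open>K\<^sub>p\<^sub>,\<^sub>q\<close> has \<open>p q w(p, q)\<close> copies.

  Some complete bipartite graph on \<open>n\<close> vertices is always optimal (\<open>copies_double_star_le\<close>), by
  a weighting argument. Let \<open>M\<close> be the largest number of copies in a \<open>K\<^sub>p\<^sub>,\<^sub>q\<close> with \<open>p + q = n\<close>. The
  ends of an edge have disjoint neighbourhoods, so their degrees \<open>p, q\<close> satisfy \<open>p + q \<le> n\<close>.
  Put \<open>q' = n - p \<ge> q\<close>; then \<open>w(p, q) \<le> w(p, q') \<le> M/(p q') = (M/n) (1/p + 1/q')\<close>, and therefore \<open>w(p, q) \<le> (M/n) (1/p + 1/q)\<close>. The sum of \<open>1/d(u) + 1/d(v)\<close> over the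
  edges counts each non-isolated vertex once, so it is at most \<open>n\<close>, and the number of copies is at most \<open>M\<close>.

  It remains to see that for \<open>S\<^sub>1\<^sub>,\<^sub>3\<close> and \<open>n \<ge> 13\<close> the balanced \<open>K\<^sub>p\<^sub>,\<^sub>q\<close> is the best one
  (\<open>scaled_copies_balanced_max\<close>). This is a polynomial inequality in the distance from balance, and the
  bound on \<open>n\<close> is sharp for it: \<open>K\<^sub>5\<^sub>,\<^sub>8\<close> ties with \<open>K\<^sub>6\<^sub>,\<^sub>7\<close>, \<open>K\<^sub>6\<^sub>,\<^sub>8\<close> ties with \<open>K\<^sub>7\<^sub>,\<^sub>7\<close>, and
  \<open>K\<^sub>5\<^sub>,\<^sub>7\<close> beats \<open>K\<^sub>6\<^sub>,\<^sub>6\<close>.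
\<close>

section \<open>Copies as injective images\<close>

definition image_graph :: "('b \<Rightarrow> 'a) \<Rightarrow> 'b ugraph \<Rightarrow> 'a ugraph" where
  "image_graph g H = UGraph (g ` verts H) ((`) g ` edges H)"

text \<open>The inverse of an isomorphism onto \<open>H\<close> presents the graph as an injective image of \<open>H\<close>, so that
  its edge set is given explicitly and not only through membership tests.\<close>

lemma isomorphic_imp_image_graph:
  assumes "simple_graph F" "simple_graph H" "isomorphic F H"
  obtains g where "inj_on g (verts H)" "F = image_graph g H"
proof -
  from assms(3) obtain f where f: "bij_betw f (verts F) (verts H)"
    and fe: "\<And>x y. \<lbrakk>x \<in> verts F; y \<in> verts F\<rbrakk> \<Longrightarrow> {x, y} \<in> edges F \<longleftrightarrow> {f x, f y} \<in> edges H"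
    unfolding isomorphic_def by blast
  define g where "g = the_inv_into (verts F) f"
  have g: "bij_betw g (verts H) (verts F)"
    unfolding g_def by (rule bij_betw_the_inv_into[OF f])
  have gf: "g (f x) = x" if "x \<in> verts F" for x
    using f that unfolding g_def bij_betw_def by (simp add: the_inv_into_f_f)
  have fg: "f (g y) = y" if "y \<in> verts H" for y
    using f that unfolding g_def bij_betw_def by (simp add: f_the_inv_into_f)
  have "edges F = (`) g ` edges H"
  proof (intro equalityI subsetI)
    fix e assume e: "e \<in> edges F"
    with assms(1) obtain x y where xy: "e = {x, y}" "x \<in> verts F" "y \<in> verts F"
      unfolding simple_graph_def by (fastforce simp: card_2_iff)
    then have "{f x, f y} \<in> edges H" using fe e by simp
    moreover have "e = g ` {f x, f y}" using xy gf by simp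
    ultimately show "e \<in> (`) g ` edges H" by (rule rev_image_eqI)
  next
    fix e assume "e \<in> (`) g ` edges H"
    then obtain e' where e': "e' \<in> edges H" "e = g ` e'" by blast
    with assms(2) obtain x y where xy: "e' = {x, y}" "x \<in> verts H" "y \<in> verts H"
      unfolding simple_graph_def by (fastforce simp: card_2_iff)
    then have "g x \<in> verts F" "g y \<in> verts F" using g by (auto dest: bij_betwE)
    then show "e \<in> edges F" using fe[of "g x" "g y"] fg xy e' by simp
  qed
  moreover have "verts F = g ` verts H" using g by (simp add: bij_betw_def)
  ultimately have "F = image_graph g H"
    unfolding image_graph_def by (cases F) simp
  moreover have "inj_on g (verts H)" using g by (simp add: bij_betw_def)
  ultimately show ?thesis using that by blast
qed

lemma isomorphic_image_graph:
  assumes "simple_graph H" "inj_on g (verts H)"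
  shows "isomorphic (image_graph g H) H"
proof -
  define f where "f = the_inv_into (verts H) g"
  have f: "bij_betw f (g ` verts H) (verts H)"
    unfolding f_def using assms(2) by (intro bij_betw_the_inv_into) (simp add: bij_betw_def)
  have fg: "f (g y) = y" if "y \<in> verts H" for y
    using assms(2) that unfolding f_def by (simp add: the_inv_into_f_f)
  have sub: "e \<subseteq> verts H" if "e \<in> edges H" for e
    using assms(1) that unfolding simple_graph_def by blast
  have "{g x, g y} \<in> (`) g ` edges H \<longleftrightarrow> {x, y} \<in> edges H"
    if "x \<in> verts H" "y \<in> verts H" for x y
  proof
    assume "{g x, g y} \<in> (`) g ` edges H"
    then obtain e where e: "e \<in> edges H" "g ` {x, y} = g ` e" by auto
    then have "{x, y} = e"
      using inj_on_image_eq_iff[OF assms(2), of "{x, y}" e] sub that by simp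
    then show "{x, y} \<in> edges H" using e by simp
  next
    assume "{x, y} \<in> edges H"
    then show "{g x, g y} \<in> (`) g ` edges H" by (rule rev_image_eqI) simp
  qed
  then show ?thesis
    unfolding isomorphic_def image_graph_def ugraph.sel using f fg by (intro exI[of _ f]) auto
qed

section \<open>Double stars inside a graph\<close>

text \<open>The double star with centres \<open>u\<close>, \<open>v\<close> and leaf sets \<open>A\<close>, \<open>B\<close>. It is a genuine double star only
  under \<open>disjoint_parts\<close>, introduced below.\<close>

definition dstar :: "'a \<Rightarrow> 'a \<Rightarrow> 'a set \<Rightarrow> 'a set \<Rightarrow> 'a ugraph" where
  "dstar u v A B = UGraph ({u, v} \<union> A \<union> B)
     (insert {u, v} ((\<lambda>x. {u, x}) ` A \<union> (\<lambda>y. {v, y}) ` B))"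

lemma image_graph_dstar:
  "image_graph g (dstar u v A B) = dstar (g u) (g v) (g ` A) (g ` B)"
  unfolding image_graph_def dstar_def by (simp add: image_Un image_image)

lemma double_star_eq_dstar:
  "double_star a b =
     dstar (Inl (Inl 0)) (Inr (Inl 0)) ((Inl \<circ> Inr) ` {..<a}) ((Inr \<circ> Inr) ` {..<b})"
proof -
  have "verts (star c) = insert (Inl 0) (Inr ` {..<c})"
    and "edges (star c) = (\<lambda>j. {Inl 0, Inr j}) ` {..<c}" for c
    unfolding complete_bipartite_def by auto
  then show ?thesis
    unfolding double_star_def dstar_def by (simp add: image_image Un_ac insert_commute)
qed

definition disjoint_parts :: "'a \<Rightarrow> 'a \<Rightarrow> 'a set \<Rightarrow> 'a set \<Rightarrow> bool" where
  "disjoint_parts u v A B \<longleftrightarrow> u \<noteq> v \<and> u \<notin> A \<union> B \<and> v \<notin> A \<union> B \<and> A \<inter> B = {}"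

lemma disjoint_parts_image:
  assumes "disjoint_parts u v A B" "inj_on g ({u, v} \<union> A \<union> B)"
  shows "disjoint_parts (g u) (g v) (g ` A) (g ` B)"
proof -
  have "g ` A \<inter> g ` B = g ` (A \<inter> B)"
    using assms(2) by (intro inj_on_image_Int[symmetric]) auto
  moreover have "g u \<in> g ` (A \<union> B) \<longleftrightarrow> u \<in> A \<union> B" "g v \<in> g ` (A \<union> B) \<longleftrightarrow> v \<in> A \<union> B"
    by (rule inj_on_image_mem_iff[OF assms(2)]; blast)+
  moreover have "g u = g v \<longleftrightarrow> u = v"
    by (rule inj_on_eq_iff[OF assms(2)]) auto
  ultimately show ?thesis using assms(1) unfolding disjoint_parts_def by (simp add: image_Un)
qed

text \<open>This makes copies concrete: each is determined by two centres and two leaf sets.\<close>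

lemma isomorphic_double_star_iff:
  assumes "simple_graph F"
  shows "isomorphic F (double_star a b) \<longleftrightarrow>
    (\<exists>u v A B. F = dstar u v A B \<and> disjoint_parts u v A B \<and> finite A \<and> card A = a \<and> finite B \<and> card B = b)"
proof
  let ?A = "(Inl \<circ> Inr) ` {..<a} :: ((nat + nat) + (nat + nat)) set"
  let ?B = "(Inr \<circ> Inr) ` {..<b} :: ((nat + nat) + (nat + nat)) set"
  let ?u = "Inl (Inl 0) :: (nat + nat) + (nat + nat)"
  let ?v = "Inr (Inl 0) :: (nat + nat) + (nat + nat)"
  assume "isomorphic F (double_star a b)"
  then obtain g where g: "inj_on g (verts (double_star a b))" "F = image_graph g (double_star a b)"
    using isomorphic_imp_image_graph[OF assms simple_graph_double_star] by blast
  have V: "verts (double_star a b) = {?u, ?v} \<union> ?A \<union> ?B"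
    by (simp add: double_star_eq_dstar dstar_def)
  note inj = g(1)[unfolded V]
  have "inj_on g ?A" "inj_on g ?B" using inj by (auto intro: inj_on_subset)
  then have "card (g ` ?A) = a" "card (g ` ?B) = b"
    by (simp_all add: card_image inj_on_def)
  moreover have "disjoint_parts (g ?u) (g ?v) (g ` ?A) (g ` ?B)"
    by (rule disjoint_parts_image[OF _ inj]) (auto simp: disjoint_parts_def)
  moreover have "F = dstar (g ?u) (g ?v) (g ` ?A) (g ` ?B)"
    using g(2) by (simp only: double_star_eq_dstar image_graph_dstar)
  ultimately show "\<exists>u v A B. F = dstar u v A B \<and> disjoint_parts u v A B \<and>
    finite A \<and> card A = a \<and> finite B \<and> card B = b" by blast
next
  assume "\<exists>u v A B. F = dstar u v A B \<and> disjoint_parts u v A B \<and> finite A \<and> card A = a \<and> finite B \<and> card B = b"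
  then obtain u v A B where F: "F = dstar u v A B" "disjoint_parts u v A B"
    and A: "finite A" "card A = a" and B: "finite B" "card B = b" by blast
  obtain hA where hA: "bij_betw hA {..<a} A"
    using ex_bij_betw_nat_finite[OF A(1)] A(2) by (auto simp: lessThan_atLeast0)
  obtain hB where hB: "bij_betw hB {..<b} B"
    using ex_bij_betw_nat_finite[OF B(1)] B(2) by (auto simp: lessThan_atLeast0)
  define g :: "(nat + nat) + (nat + nat) \<Rightarrow> 'a"
    where "g = case_sum (case_sum (\<lambda>_. u) hA) (case_sum (\<lambda>_. v) hB)"
  have im: "hA ` {..<a} = A" "hB ` {..<b} = B" using hA hB by (simp_all add: bij_betw_def)
  have F_eq: "image_graph g (double_star a b) = F"
    unfolding double_star_eq_dstar image_graph_dstar F g_def using im by (simp add: image_comp comp_def)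
  have "hA i \<noteq> hB j" if "i < a" "j < b" for i j
    using F(2) im that unfolding disjoint_parts_def by blast
  moreover from this have "hB j \<noteq> hA i" if "i < a" "j < b" for i j
    using that by metis
  ultimately have "inj_on g (verts (double_star a b))"
    using F(2) hA hB im unfolding g_def disjoint_parts_def double_star_eq_dstar dstar_def bij_betw_def
    by (auto simp: inj_on_def)
  then show "isomorphic F (double_star a b)"
    using isomorphic_image_graph[OF simple_graph_double_star, of g a b] F_eq by simp
qed

definition nbrs :: "'a ugraph \<Rightarrow> 'a \<Rightarrow> 'a set" where
  "nbrs G u = {v. {u, v} \<in> edges G}"

abbreviation deg :: "'a ugraph \<Rightarrow> 'a \<Rightarrow> nat" where
  "deg G u \<equiv> card (nbrs G u)"

definition arcs :: "'a ugraph \<Rightarrow> ('a \<times> 'a) set" where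
  "arcs G = {(u, v). {u, v} \<in> edges G}"

lemma mem_nbrs_dstar_iff:
  "x \<in> nbrs (dstar u v A B) w \<longleftrightarrow>
     w = u \<and> x \<in> insert v A \<or> w = v \<and> x \<in> insert u B \<or> w \<in> A \<and> x = u \<or> w \<in> B \<and> x = v"
proof -
  have "{w, x} \<in> (\<lambda>y. {c, y}) ` C \<longleftrightarrow> w = c \<and> x \<in> C \<or> w \<in> C \<and> x = c" for c C
    by (auto simp: doubleton_eq_iff image_iff)
  then show ?thesis
    unfolding nbrs_def dstar_def ugraph.sel mem_Collect_eq Un_iff insert_iff doubleton_eq_iff by blast
qed

lemma nbrs_dstar:
  assumes "disjoint_parts u v A B"
  shows "nbrs (dstar u v A B) u = insert v A"
    and "nbrs (dstar u v A B) v = insert u B"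
    and "w \<noteq> u \<Longrightarrow> w \<noteq> v \<Longrightarrow> nbrs (dstar u v A B) w \<subseteq> {u} \<or> nbrs (dstar u v A B) w \<subseteq> {v}"
proof -
  note d = assms[unfolded disjoint_parts_def]
  show "nbrs (dstar u v A B) u = insert v A" "nbrs (dstar u v A B) v = insert u B"
    by (rule set_eqI, unfold mem_nbrs_dstar_iff, use d in blast)+
  show "nbrs (dstar u v A B) w \<subseteq> {u} \<or> nbrs (dstar u v A B) w \<subseteq> {v}" if "w \<noteq> u" "w \<noteq> v"
    using d that unfolding subset_iff mem_nbrs_dstar_iff by blast
qed

lemma deg_dstar:
  assumes "disjoint_parts u v A B" "finite A" "finite B"
  shows "deg (dstar u v A B) u = Suc (card A)"
    and "deg (dstar u v A B) v = Suc (card B)"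
    and "w \<noteq> u \<Longrightarrow> w \<noteq> v \<Longrightarrow> deg (dstar u v A B) w \<le> 1"
proof -
  show "deg (dstar u v A B) u = Suc (card A)" "deg (dstar u v A B) v = Suc (card B)"
    using assms by (auto simp: nbrs_dstar disjoint_parts_def)
  assume "w \<noteq> u" "w \<noteq> v"
  then have "nbrs (dstar u v A B) w \<subseteq> {u} \<or> nbrs (dstar u v A B) w \<subseteq> {v}"
    by (rule nbrs_dstar(3)[OF assms(1)])
  then show "deg (dstar u v A B) w \<le> 1"
    using card_mono[of "{u}"] card_mono[of "{v}"] by fastforce
qed

text \<open>The centres are recovered from the degrees: only \<open>u\<close> has degree \<open>a + 1\<close> and only \<open>v\<close> has degree
  \<open>b + 1\<close>, since all other degrees are at most \<open>1\<close>. Without \<open>a \<noteq> b\<close> the two ends could be swapped.\<close>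

lemma dstar_inject:
  assumes "dstar u v A B = dstar u' v' A' B'"
    and s: "disjoint_parts u v A B" "finite A" "finite B" and s': "disjoint_parts u' v' A' B'" "finite A'" "finite B'"
    and c: "card A = a" "card A' = a" "card B = b" "card B' = b" "a \<ge> 1" "b \<ge> 1" "a \<noteq> b"
  shows "u = u' \<and> v = v' \<and> A = A' \<and> B = B'"
proof -
  let ?D = "dstar u v A B"
  have "deg ?D u' = Suc a" "deg ?D v' = Suc b"
    using deg_dstar(1,2)[OF s'] assms(1) c by simp_all
  moreover have "deg ?D u = Suc a" "deg ?D v = Suc b"
    using deg_dstar(1,2)[OF s] c by simp_all
  ultimately have uv: "u = u'" "v = v'"
    using deg_dstar(3)[OF s, of u'] deg_dstar(3)[OF s, of v'] c by fastforce+
  have "insert v A = insert v A'" "insert u B = insert u B'"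
    using nbrs_dstar(1,2)[OF s(1)] nbrs_dstar(1,2)[OF s'(1)] assms(1) uv by simp_all
  then show ?thesis using s(1) s'(1) uv unfolding disjoint_parts_def by (simp add: insert_ident)
qed

section \<open>Counting copies in a triangle-free graph\<close>

lemma edgeD:
  assumes "simple_graph G" "{x, y} \<in> edges G"
  shows "x \<in> verts G" "y \<in> verts G" "x \<noteq> y"
proof -
  have "{x, y} \<subseteq> verts G \<and> card {x, y} = 2"
    using assms unfolding simple_graph_def by blast
  then show "x \<in> verts G" "y \<in> verts G" "x \<noteq> y" by auto
qed

lemma finite_verts: "simple_graph G \<Longrightarrow> finite (verts G)"
  unfolding simple_graph_def by blast

lemma nbrs_subset_verts: "simple_graph G \<Longrightarrow> nbrs G u \<subseteq> verts G"
  unfolding nbrs_def using edgeD(2) by fast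

lemma finite_nbrs: "simple_graph G \<Longrightarrow> finite (nbrs G u)"
  by (rule finite_subset[OF nbrs_subset_verts finite_verts])

lemma arcs_eq_Sigma: "simple_graph G \<Longrightarrow> arcs G = Sigma (verts G) (nbrs G)"
  unfolding arcs_def nbrs_def by (auto dest: edgeD(1))

lemma arcs_memD:
  assumes "(u, v) \<in> arcs G" shows "v \<in> nbrs G u" "u \<in> nbrs G v"
  using assms unfolding arcs_def nbrs_def by (simp_all add: insert_commute)

lemma finite_arcs: "simple_graph G \<Longrightarrow> finite (arcs G)"
  by (simp add: arcs_eq_Sigma finite_verts finite_nbrs)

text \<open>Triangle-freeness is what makes the choices of \<open>A\<close> and \<open>B\<close> independent: a common element of \<open>A\<close> and
  \<open>B\<close> would close a triangle with \<open>u\<close> and \<open>v\<close>.\<close>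

lemma subgraph_of_dstar_iff:
  assumes "simple_graph G" "triangle_free G"
  shows "subgraph_of (dstar u v A B) G \<and> disjoint_parts u v A B \<and> finite A \<and> finite B \<longleftrightarrow>
    (u, v) \<in> arcs G \<and> A \<subseteq> nbrs G u - {v} \<and> B \<subseteq> nbrs G v - {u}" (is "?L \<longleftrightarrow> ?R")
proof
  assume ?L
  then show ?R
    unfolding subgraph_of_def dstar_def disjoint_parts_def arcs_def nbrs_def by auto
next
  assume R: ?R
  then have e: "{u, v} \<in> edges G" "\<And>x. x \<in> A \<Longrightarrow> {u, x} \<in> edges G" "\<And>y. y \<in> B \<Longrightarrow> {v, y} \<in> edges G"
    unfolding arcs_def nbrs_def by auto
  note e' = edgeD[OF assms(1)]
  have "A \<inter> B = {}"
    using assms(2) e unfolding triangle_free_def by blast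
  moreover have "u \<noteq> v" "u \<notin> A" "v \<notin> B"
    using e(1)[THEN e'(3)] e(2)[THEN e'(3)] e(3)[THEN e'(3)] by auto
  ultimately have s: "disjoint_parts u v A B" using R unfolding disjoint_parts_def by blast
  have fin: "finite A" "finite B"
    using R finite_nbrs[OF assms(1)] by (meson Diff_subset finite_subset)+
  have "simple_graph (dstar u v A B)"
    using s fin unfolding simple_graph_def dstar_def disjoint_parts_def by (auto simp: card_2_iff')
  moreover have "verts (dstar u v A B) \<subseteq> verts G" "edges (dstar u v A B) \<subseteq> edges G"
    unfolding dstar_def using e e(1)[THEN e'(1)] e(1)[THEN e'(2)] e(2)[THEN e'(2)] e(3)[THEN e'(2)] by auto
  ultimately show ?L using s fin unfolding subgraph_of_def by blast
qed

text \<open>Choose the ordered edge of centres, then \<open>a\<close> further neighbours of one and \<open>b\<close> of the other.\<close>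

lemma copies_double_star_eq:
  assumes G: "simple_graph G" "triangle_free G" and ab: "a \<ge> 1" "b \<ge> 1" "a \<noteq> b"
  shows "copies (double_star a b) G =
    (\<Sum>(u, v)\<in>arcs G. ((deg G u - 1) choose a) * ((deg G v - 1) choose b))"
proof -
  define S where "S = (\<lambda>(u, v). {A. A \<subseteq> nbrs G u - {v} \<and> card A = a} \<times>
                                 {B. B \<subseteq> nbrs G v - {u} \<and> card B = b})"
  let ?h = "\<lambda>((u, v), (A, B)). dstar u v A B"
  have T: "((u, v), (A, B)) \<in> Sigma (arcs G) S \<longleftrightarrow>
      subgraph_of (dstar u v A B) G \<and> disjoint_parts u v A B \<and> finite A \<and> card A = a \<and> finite B \<and> card B = b"
    for u v A B
    using subgraph_of_dstar_iff[OF G, of u v A B] unfolding S_def by auto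
  have iso: "isomorphic F (double_star a b) \<longleftrightarrow>
      (\<exists>u v A B. F = dstar u v A B \<and> ((u, v), (A, B)) \<in> Sigma (arcs G) S)" if "subgraph_of F G" for F
    using isomorphic_double_star_iff[of F a b] that unfolding T subgraph_of_def by auto
  have "bij_betw ?h (Sigma (arcs G) S) {F. subgraph_of F G \<and> isomorphic F (double_star a b)}"
    unfolding bij_betw_def
  proof
    show "inj_on ?h (Sigma (arcs G) S)"
    proof (rule inj_onI)
      fix s t assume st: "s \<in> Sigma (arcs G) S" "t \<in> Sigma (arcs G) S" "?h s = ?h t"
      obtain u v A B u' v' A' B' where "s = ((u, v), (A, B))" "t = ((u', v'), (A', B'))"
        by (metis surj_pair)
      then show "s = t"
        using st T dstar_inject[of u v A B u' v' A' B' a b] ab by auto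
    qed
    show "?h ` Sigma (arcs G) S = {F. subgraph_of F G \<and> isomorphic F (double_star a b)}"
    proof (intro equalityI subsetI)
      fix F assume "F \<in> ?h ` Sigma (arcs G) S"
      then obtain s where "s \<in> Sigma (arcs G) S" "F = ?h s" by (rule imageE)
      moreover obtain u v A B where "s = ((u, v), (A, B))" by (metis surj_pair)
      ultimately have F: "F = dstar u v A B" "((u, v), (A, B)) \<in> Sigma (arcs G) S" by simp_all
      then have "subgraph_of F G" using T by simp
      then show "F \<in> {F. subgraph_of F G \<and> isomorphic F (double_star a b)}"
        using iso F by auto
    next
      fix F assume "F \<in> {F. subgraph_of F G \<and> isomorphic F (double_star a b)}"
      then obtain u v A B where "F = dstar u v A B" "((u, v), (A, B)) \<in> Sigma (arcs G) S"
        using iso by auto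
      then show "F \<in> ?h ` Sigma (arcs G) S"
        by (intro image_eqI[of _ _ "((u, v), (A, B))"]) simp_all
    qed
  qed
  then have "copies (double_star a b) G = card (Sigma (arcs G) S)"
    unfolding copies_def by (simp add: bij_betw_same_card)
  also have "\<dots> = (\<Sum>p\<in>arcs G. card (S p))"
  proof (rule card_SigmaI[OF finite_arcs[OF G(1)]])
    show "\<forall>p\<in>arcs G. finite (S p)"
      unfolding S_def using finite_nbrs[OF G(1)] by (simp add: case_prod_unfold)
  qed
  also have "\<dots> = (\<Sum>(u, v)\<in>arcs G. ((deg G u - 1) choose a) * ((deg G v - 1) choose b))"
  proof (rule sum.cong[OF refl])
    fix p assume p: "p \<in> arcs G"
    obtain u v where "p = (u, v)" by (cases p)
    moreover from this p have "v \<in> nbrs G u" "u \<in> nbrs G v" by (simp_all add: arcs_memD)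
    ultimately show "card (S p) = (case p of (u, v) \<Rightarrow> ((deg G u - 1) choose a) * ((deg G v - 1) choose b))"
      unfolding S_def by (simp add: card_cartesian_product n_subsets finite_nbrs[OF G(1)])
  qed
  finally show ?thesis .
qed

section \<open>Complete bipartite graphs are optimal\<close>

text \<open>The number of copies whose central edge is a given edge with end degrees \<open>p\<close> and \<open>q\<close>; the two
  terms are the two orientations.\<close>

definition edge_weight :: "nat \<Rightarrow> nat \<Rightarrow> nat \<Rightarrow> nat \<Rightarrow> nat" where
  "edge_weight a b p q = ((p - 1) choose a) * ((q - 1) choose b) + ((q - 1) choose a) * ((p - 1) choose b)"

lemma edge_weight_mono: "q \<le> q' \<Longrightarrow> edge_weight a b p q \<le> edge_weight a b p q'"
  unfolding edge_weight_def
  by (intro add_mono mult_mono binomial_right_mono diff_le_mono) auto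

lemma sum_arcs_swap:
  "(\<Sum>(u, v)\<in>arcs G. h v u) = (\<Sum>(u, v)\<in>arcs G. h u v)"
  by (rule sum.reindex_bij_witness[of _ prod.swap prod.swap])
     (auto simp: arcs_def insert_commute)

text \<open>Each vertex that is not isolated receives \<open>1 / d\<close> from each of its \<open>d\<close> arcs, hence \<open>1\<close> in total.\<close>

lemma sum_arcs_inverse_deg_le:
  assumes "simple_graph G"
  shows "(\<Sum>(u, v)\<in>arcs G. 1 / real (deg G u)) \<le> real (card (verts G))"
proof -
  have "(\<Sum>(u, v)\<in>arcs G. 1 / real (deg G u)) = (\<Sum>u\<in>verts G. \<Sum>v\<in>nbrs G u. 1 / real (deg G u))"
    unfolding arcs_eq_Sigma[OF assms]
    by (rule sum.Sigma[symmetric]) (simp_all add: assms finite_verts finite_nbrs)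
  also have "\<dots> \<le> (\<Sum>u\<in>verts G. 1)" by (rule sum_mono) simp
  finally show ?thesis by simp
qed

lemma deg_add_deg_le:
  assumes "simple_graph G" "triangle_free G" "(u, v) \<in> arcs G"
  shows "deg G u + deg G v \<le> card (verts G)"
proof -
  have "nbrs G u \<inter> nbrs G v = {}"
    using assms(2,3) unfolding nbrs_def arcs_def triangle_free_def by blast
  then have "deg G u + deg G v = card (nbrs G u \<union> nbrs G v)"
    by (simp add: card_Un_disjoint finite_nbrs[OF assms(1)])
  also have "\<dots> \<le> card (verts G)"
    by (intro card_mono finite_verts Un_least nbrs_subset_verts assms(1))
  finally show ?thesis .
qed

text \<open>The weight of an edge is compared with its share \<open>1/d(u) + 1/d(v)\<close> of the vertex count, and each
  share is worth at most \<open>M / n\<close> copies. If \<open>M\<close> is the maximum over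
  all parts, a complete bipartite graph attaining it gives equality throughout.\<close>

lemma copies_double_star_le:
  assumes G: "simple_graph G" "triangle_free G" and ab: "a \<ge> 1" "b \<ge> 1" "a \<noteq> b"
    and M: "\<And>p q. p + q = card (verts G) \<Longrightarrow> p * q * edge_weight a b p q \<le> M"
  shows "copies (double_star a b) G \<le> M"
proof -
  let ?n = "card (verts G)"
  let ?w = "edge_weight a b"
  let ?d = "deg G"
  have arc: "real (?w (?d u) (?d v)) \<le> M / ?n * (1 / ?d u + 1 / ?d v)" if uv: "(u, v) \<in> arcs G" for u v
  proof -
    define p where "p = ?d u"
    define q where "q = ?d v"
    \<comment> \<open>The edge is compared with one of the complete bipartite graph with parts \<open>p\<close> and \<open>q'\<close>.\<close>
    define q' where "q' = ?n - p"
    have le: "p + q \<le> ?n" unfolding p_def q_def by (rule deg_add_deg_le[OF G uv])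
    have pos: "p > 0" "q > 0"
      using arcs_memD[OF uv] finite_nbrs[OF G(1)] unfolding p_def q_def
      by (auto simp: card_gt_0_iff)
    have q': "q \<le> q'" "p + q' = ?n" using le unfolding q'_def by auto
    then have pos': "q' > 0" "?n > 0" using pos by auto
    have "real p * real q' * real (?w p q') \<le> M"
      using M[OF q'(2)] by (metis of_nat_le_iff of_nat_mult)
    then have "real (?w p q') \<le> M / (real p * real q')"
      using pos pos' by (simp add: field_simps)
    also have "\<dots> = M / ?n * (?n / (real p * real q'))"
      using pos' by simp
    also have "?n / (real p * real q') = 1 / p + 1 / q'"
      using pos pos' unfolding q'(2)[symmetric] by (simp add: field_simps)
    also have "M / ?n * (1 / p + 1 / q') \<le> M / ?n * (1 / p + 1 / q)"
      using pos pos' q' by (intro mult_left_mono add_left_mono divide_left_mono) auto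
    finally show ?thesis
      using edge_weight_mono[OF q'(1), of a b p] unfolding p_def[symmetric] q_def[symmetric] by simp
  qed
  let ?c = "\<lambda>u v. real (((?d u - 1) choose a) * ((?d v - 1) choose b))"
  let ?I = "\<Sum>(u, v)\<in>arcs G. 1 / real (?d u)"
  have "real (copies (double_star a b) G) = (\<Sum>(u, v)\<in>arcs G. ?c u v)"
    by (simp add: copies_double_star_eq[OF G ab] case_prod_unfold)
  \<comment> \<open>Adding the reversed sum symmetrises the summand into the edge weight.\<close>
  then have "2 * real (copies (double_star a b) G) = (\<Sum>(u, v)\<in>arcs G. ?c u v) + (\<Sum>(u, v)\<in>arcs G. ?c v u)"
    using sum_arcs_swap[of ?c G] by simp
  also have "\<dots> = (\<Sum>(u, v)\<in>arcs G. real (?w (?d u) (?d v)))"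
    by (simp add: edge_weight_def sum.distrib[symmetric] case_prod_unfold)
  also have "\<dots> \<le> (\<Sum>(u, v)\<in>arcs G. M / ?n * (1 / ?d u + 1 / ?d v))"
    using arc by (intro sum_mono) auto
  also have "\<dots> = M / ?n * (?I + (\<Sum>(u, v)\<in>arcs G. 1 / real (?d v)))"
    by (simp only: sum.distrib[symmetric] sum_distrib_left case_prod_unfold)
  also have "\<dots> = M / ?n * (2 * ?I)"
    using sum_arcs_swap[of "\<lambda>u v. 1 / real (?d u)" G] by simp
  also have "\<dots> \<le> M / ?n * (2 * ?n)"
    using sum_arcs_inverse_deg_le[OF G(1)] by (intro mult_left_mono) auto
  also have "\<dots> \<le> 2 * M" by simp
  finally show ?thesis by simp
qed

lemma simple_graph_complete_bipartite: "simple_graph (complete_bipartite p q)"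
  unfolding simple_graph_def complete_bipartite_def by auto

lemma triangle_free_complete_bipartite: "triangle_free (complete_bipartite p q)"
  unfolding triangle_free_def complete_bipartite_def by (auto simp: doubleton_eq_iff)

lemma copies_complete_bipartite:
  assumes "a \<ge> 1" "b \<ge> 1" "a \<noteq> b"
  shows "copies (double_star a b) (complete_bipartite p q) = p * q * edge_weight a b p q"
proof -
  let ?K = "complete_bipartite p q"
  let ?c = "\<lambda>u v. ((deg ?K u - 1) choose a) * ((deg ?K v - 1) choose b)"
  have L: "deg ?K (Inl i) = q" if "i < p" for i
  proof -
    have "nbrs ?K (Inl i) = Inr ` {..<q}"
      using that unfolding nbrs_def complete_bipartite_def by (auto simp: doubleton_eq_iff)
    then show ?thesis by (simp add: card_image)
  qed
  have R: "deg ?K (Inr j) = p" if "j < q" for j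
  proof -
    have "nbrs ?K (Inr j) = Inl ` {..<p}"
      using that unfolding nbrs_def complete_bipartite_def by (auto simp: doubleton_eq_iff)
    then show ?thesis by (simp add: card_image)
  qed
  let ?X = "(\<lambda>(i, j). (Inl i, Inr j)) ` ({..<p} \<times> {..<q}) :: ((nat + nat) \<times> (nat + nat)) set"
  let ?Y = "(\<lambda>(i, j). (Inr j, Inl i)) ` ({..<p} \<times> {..<q}) :: ((nat + nat) \<times> (nat + nat)) set"
  have "arcs ?K = ?X \<union> ?Y"
    unfolding arcs_def complete_bipartite_def by (auto simp: doubleton_eq_iff)
  then have "(\<Sum>(u, v)\<in>arcs ?K. ?c u v) = (\<Sum>(u, v)\<in>?X. ?c u v) + (\<Sum>(u, v)\<in>?Y. ?c u v)"
    by (simp only:) (rule sum.union_disjoint, auto)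
  also have "(\<Sum>(u, v)\<in>?X. ?c u v) = (\<Sum>(i, j)\<in>{..<p} \<times> {..<q}. ((q - 1) choose a) * ((p - 1) choose b))"
    by (subst sum.reindex, force simp: inj_on_def, rule sum.cong[OF refl], force simp: L R)
  also have "(\<Sum>(u, v)\<in>?Y. ?c u v) = (\<Sum>(i, j)\<in>{..<p} \<times> {..<q}. ((p - 1) choose a) * ((q - 1) choose b))"
    by (subst sum.reindex, force simp: inj_on_def, rule sum.cong[OF refl], force simp: L R)
  finally show ?thesis
    unfolding copies_double_star_eq[OF simple_graph_complete_bipartite triangle_free_complete_bipartite assms]
    by (simp add: edge_weight_def card_cartesian_product algebra_simps)
qed

section \<open>The balanced complete bipartite graph is best for \<open>n \<ge> 13\<close>\<close>

lemma six_choose_three: "6 * int (x choose 3) = int x * (int x - 1) * (int x - 2)"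
proof (induction x)
  case (Suc x)
  have "2 * int (x choose 2) = int x * (int x - 1)"
    by (induction x) (simp_all add: numeral_2_eq_2 algebra_simps)
  with Suc show ?case by (simp add: numeral_3_eq_3 numeral_2_eq_2 algebra_simps)
qed simp

text \<open>Six times the number of copies of \<open>S\<^sub>1\<^sub>,\<^sub>3\<close> in \<open>K\<^sub>p\<^sub>,\<^sub>q\<close>; the last factor comes from
  \<open>6 (x choose 3) = x (x - 1) (x - 2)\<close> at \<open>x = q - 1\<close> and \<open>x = p - 1\<close>.\<close>

definition scaled_copies :: "int \<Rightarrow> int \<Rightarrow> int" where
  "scaled_copies p q = p * q * (p - 1) * (q - 1) * ((p - 2) * (p - 3) + (q - 2) * (q - 3))"

lemma scaled_copies_edge_weight: "6 * int (p * q * edge_weight 1 3 p q) = scaled_copies (int p) (int q)"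
proof (cases "p = 0 \<or> q = 0")
  case True
  then show ?thesis by (auto simp: scaled_copies_def)
next
  case False
  then have pq: "int (p - 1) = int p - 1" "int (q - 1) = int q - 1" by auto
  have "6 * int (p * q * edge_weight 1 3 p q) =
    int p * int q * (int (p - 1) * (6 * int ((q - 1) choose 3)) + int (q - 1) * (6 * int ((p - 1) choose 3)))"
    unfolding edge_weight_def choose_one of_nat_mult of_nat_add by algebra
  also have "\<dots> = scaled_copies (int p) (int q)"
    unfolding six_choose_three pq scaled_copies_def by algebra
  finally show ?thesis .
qed

text \<open>With \<open>n = 2k + 2\<close> the number of copies depends only on \<open>(p - 1)(q - 1) = k\<^sup>2 - J\<close>, where \<open>J = i\<^sup>2\<close>.
  The loss against \<open>J = 0\<close> is \<open>J\<close> times a concave quadratic in \<open>J\<close>, which is written below around its value at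
  the smallest nonzero \<open>J = 1\<close>. That value vanishes at \<open>k = 6\<close>, which is the tie at \<open>n = 14\<close>.\<close>

lemma scaled_copies_even:
  fixes k i :: int
  assumes "k \<ge> 6" "\<bar>i\<bar> \<le> k"
  shows "scaled_copies (k + 1 - i) (k + 1 + i) \<le> scaled_copies (k + 1) (k + 1)"
proof (cases "i = 0")
  case False
  define J where "J = i\<^sup>2"
  have J: "J \<ge> 1" "J \<le> k\<^sup>2"
    using False assms unfolding J_def by (auto simp: power2_le_iff_abs_le int_one_le_iff_zero_less)
  have "scaled_copies (k + 1) (k + 1) - scaled_copies (k + 1 - i) (k + 1 + i) =
      J * (2 * k * ((k - 6) * (k\<^sup>2 - 1)) + (J - 1) * (2 * (k\<^sup>2 - J) + (10 * k - 4)))"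
    unfolding scaled_copies_def J_def by algebra
  also have "\<dots> \<ge> 0"
    using J assms by (intro mult_nonneg_nonneg add_nonneg_nonneg) auto
  finally show ?thesis by simp
qed simp

text \<open>The same argument with \<open>n = 2k + 3\<close> and \<open>(p - 1)(q - 1) = k (k + 1) - J\<close>, where now
  \<open>J = i (i + 1)\<close> is at least \<open>2\<close> when nonzero. The value at \<open>J = 2\<close> vanishes at \<open>k = 5\<close>, which is the tie
  at \<open>n = 13\<close>.\<close>

lemma scaled_copies_odd:
  fixes k i :: int
  assumes "k \<ge> 5" "0 \<le> i" "i \<le> k"
  shows "scaled_copies (k + 1 - i) (k + 2 + i) \<le> scaled_copies (k + 1) (k + 2)"
proof (cases "i = 0")
  case False
  define J where "J = i * (i + 1)"
  have "1 * 2 \<le> i * (i + 1)" using False assms by (intro mult_mono) auto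
  moreover have "i * (i + 1) \<le> k * (k + 1)" using assms by (intro mult_mono) auto
  ultimately have J: "J \<ge> 2" "J \<le> k * (k + 1)" unfolding J_def by auto
  have "scaled_copies (k + 1) (k + 2) - scaled_copies (k + 1 - i) (k + 2 + i) =
      J * (2 * k * ((k - 5) * ((k + 2) * (k - 1))) + (J - 2) * (2 * (k * (k + 1) - J) + (10 * k - 2)))"
    unfolding scaled_copies_def J_def by algebra
  also have "\<dots> \<ge> 0"
    using J assms by (intro mult_nonneg_nonneg add_nonneg_nonneg) auto
  finally show ?thesis by simp
qed simp

lemma scaled_copies_commute: "scaled_copies p q = scaled_copies q p"
  unfolding scaled_copies_def by (simp add: algebra_simps)

lemma scaled_copies_balanced_max:
  fixes p q :: nat
  assumes "p + q = n" "n \<ge> 13"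
  shows "scaled_copies (int p) (int q) \<le> scaled_copies (int (n div 2)) (int ((n + 1) div 2))"
  using assms(1)
proof (induction p q rule: linorder_wlog)
  case (le p q)
  show ?case
  proof (cases "p = 0")
    case True
    then have "scaled_copies (int p) (int q) = 0" by (simp add: scaled_copies_def)
    moreover have "scaled_copies (int (n div 2)) (int ((n + 1) div 2)) \<ge> 0"
      using assms(2) unfolding scaled_copies_def by (intro mult_nonneg_nonneg add_nonneg_nonneg) auto
    ultimately show ?thesis by simp
  next
    case False
    show ?thesis
    proof (cases "even n")
      case True
      \<comment> \<open>With \<open>n = 2h\<close>, take \<open>k = h - 1\<close> and let \<open>i = h - p\<close> be the distance from balance.\<close>
      then obtain h where h: "n = 2 * h" by blast
      have "scaled_copies (int h - 1 + 1 - (int h - int p)) (int h - 1 + 1 + (int h - int p))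
          \<le> scaled_copies (int h - 1 + 1) (int h - 1 + 1)"
        using h assms(2) le False by (intro scaled_copies_even) auto
      moreover have "int q = int h + (int h - int p)" using h le by auto
      moreover have "n div 2 = h" "(n + 1) div 2 = h" using h by auto
      ultimately show ?thesis by simp
    next
      case odd: False
      then obtain h where h: "n = 2 * h + 1" by (elim oddE)
      have "scaled_copies (int h - 1 + 1 - (int h - int p)) (int h - 1 + 2 + (int h - int p))
          \<le> scaled_copies (int h - 1 + 1) (int h - 1 + 2)"
        using h assms(2) le False by (intro scaled_copies_odd) auto
      moreover have "int q = int h + 1 + (int h - int p)" using h le by auto
      moreover have "n div 2 = h" "(n + 1) div 2 = h + 1" using h by auto
      ultimately show ?thesis by (simp add: add.commute)
    qed
  qed
next
  case (sym p q)
  then show ?case by (metis add.commute scaled_copies_commute)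
qed

theorem theorem4:
  fixes n :: nat and G :: "'a ugraph"
  assumes "n \<ge> 13"
    and "simple_graph G" and "card (verts G) = n" and "triangle_free G"
  shows "copies (double_star 1 3) G \<le> copies (double_star 1 3) (turan_graph2 n)"
proof (rule copies_double_star_le[OF assms(2,4)])
  fix p q assume "p + q = card (verts G)"
  then have "scaled_copies (int p) (int q) \<le> scaled_copies (int (n div 2)) (int ((n + 1) div 2))"
    using assms by (intro scaled_copies_balanced_max) auto
  then have "p * q * edge_weight 1 3 p q
      \<le> n div 2 * ((n + 1) div 2) * edge_weight 1 3 (n div 2) ((n + 1) div 2)"
    unfolding scaled_copies_edge_weight[symmetric] by linarith
  then show "p * q * edge_weight 1 3 p q \<le> copies (double_star 1 3) (turan_graph2 n)"
    unfolding turan_graph2_def by (simp add: copies_complete_bipartite)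
qed auto

end
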